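(* Let $\lambda$ be a positive integer and let $k\in\{2,3,4,5\}$. Then the Poisson distribution of order $k$ with parameter $\lambda$ has a unique mode, namely \[ m_{k,\lambda}=\frac{\lambda k(k+1)}{2}-\left\lfloor \frac{k}{2}\right\rfloor, \] i.e., $f_k(x;\lambda)$ attains its maximum over $x\in\{0,1,2,\dots\}$ at exactly one point, which is $x=\lambda k(k+1)/2-\lfloor k/2\rfloor$.
   Context: For a positive integer $k$ and real $\lambda>0$, the Poisson distribution of order $k$ with parameter $\lambda$ is the distribution on $\{0,1,2,\dots\}$ with probability mass function \[ f_k(x;\lambda)=\sum e^{-k\lambda}\frac{\lambda^{x_1+x_2+\cdots+x_k}}{x_1!\,x_2!\cdots x_k!},\qquad x=0,1,2,\dots, \] where the sum is over all $k$-tuples $(x_1,\dots,x_k)$ of nonnegative integers with $x_1+2x_2+\cdots+kx_k=x$. Equivalently, its probability generating function is $\sum_{x\ge0}f_k(x;\lambda)s^x=e^{\lambda(-k+s+s^2+\cdots+s^k)}$. A mode is a value of $x$ at which $f_k(x;\lambda)$ is maximal. $\lfloor u\rfloor$ denotes the greatest integer not exceeding $u$. *)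

theory Defs
  imports "HOL-Analysis.Analysis"
begin

text \<open>Probability mass function of the Poisson distribution of order k with parameter lam:
  sum over k-tuples (x_1,...,x_k) of nonnegative integers with x_1 + 2 x_2 + ... + k x_k = x.
  A k-tuple is represented as an extensional function on {..<k}, with component i
  standing for x_(i+1); each component is necessarily at most x.\<close>
definition poisson_order_pmf :: "nat \<Rightarrow> real \<Rightarrow> nat \<Rightarrow> real" where
  "poisson_order_pmf k lam x =
     (\<Sum>xs \<in> {xs \<in> {..<k} \<rightarrow>\<^sub>E {..x}. (\<Sum>i<k. (i + 1) * xs i) = x}.
        exp (- real k * lam) * lam ^ (\<Sum>i<k. xs i) / (\<Prod>i<k. fact (xs i)))"

end

theory Submission
  imports Defs
begin

text \<open>
  Up to the factor \<open>exp (- k * lam)\<close> the mass function is the coefficient sequence \<open>a\<close> of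
  \<open>exp (lam * (s + \<dots> + s ^ k))\<close>, so \<open>x * a x = lam * (\<Sum>j=1..k. j * a (x - j))\<close>. Put
  \<open>N = lam * k * (k + 1) / 2\<close>. For \<open>x \<ge> N\<close> the recurrence bounds \<open>a x\<close> by a weighted average of
  earlier values, so it suffices to show that \<open>a\<close> increases up to \<open>m = N - k div 2\<close> and, for \<open>k \<ge> 4\<close>,
  drops from \<open>m\<close> to \<open>m + 1 = N - 1\<close>.

  Passing from \<open>lam\<close> to \<open>lam + 1\<close> convolves \<open>a\<close> with a nonnegative sequence starting with 1, which
  preserves monotonicity up to \<open>m\<close>; hence only the window of the \<open>k * (k + 1) / 2\<close> next places has to be
  treated. In terms of the differences \<open>d x = a x - a (x - 1)\<close> the recurrence is
  \<open>lam * (\<Sum>l<k. C l * d (x - l)) = (N - x) * a x\<close> with \<open>C l = (l + 1) + \<dots> + k\<close>. A suitable integer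
  combination of these relations at \<open>x, x - 1, x - 2, \<dots>\<close> (an approximate inverse of the filter \<open>C\<close>)
  isolates \<open>d x\<close>: since the earlier differences are nonnegative, it determines the sign of \<open>d x\<close>
  for all large \<open>lam\<close>. The remaining values of \<open>lam\<close> are settled by integer arithmetic.
\<close>

section \<open>The coefficient sequence\<close>

definition order_gf :: "nat \<Rightarrow> real \<Rightarrow> real fps" where
  "order_gf k lam = fps_compose (fps_exp lam) (\<Sum>j=1..k. fps_X ^ j)"

abbreviation order_coeff :: "nat \<Rightarrow> real \<Rightarrow> nat \<Rightarrow> real" where
  "order_coeff k lam x \<equiv> fps_nth (order_gf k lam) x"

lemma order_gf_nth_0 [simp]: "order_coeff k lam 0 = 1"
  by (simp add: order_gf_def fps_compose_nth)

lemma sum_fps_X_nth: "fps_nth (\<Sum>j=1..k. fps_X ^ j :: real fps) n = (if 1 \<le> n \<and> n \<le> k then 1 else 0)"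
proof -
  have "fps_nth (\<Sum>j=1..k. fps_X ^ j :: real fps) n = (\<Sum>j=1..k. if j = n then 1 else 0)"
    unfolding fps_sum_nth by (intro sum.cong) auto
  also have "\<dots> = (if 1 \<le> n \<and> n \<le> k then 1 else 0)" by simp
  finally show ?thesis .
qed

lemma order_gf_add: "order_gf k (a + b) = order_gf k a * order_gf k b"
  unfolding order_gf_def fps_exp_add_mult
  by (rule fps_compose_mult_distrib) (simp only: sum_fps_X_nth, simp)

lemma fps_deriv_exp_compose:
  fixes g :: "'a::field_char_0 fps"
  assumes "fps_nth g 0 = 0"
  shows "fps_deriv (fps_compose (fps_exp c) g) = fps_const c * fps_compose (fps_exp c) g * fps_deriv g"
  using assms by (simp add: fps_compose_deriv fps_compose_mult_distrib)

text \<open>Compare coefficients in \<open>F' = lam * F * g'\<close> for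
  \<open>F = exp (lam * g)\<close>. The \<open>if\<close> assigns 0 to negative indices, where
  truncated subtraction would give the value at 0.\<close>

lemma order_coeff_rec:
  "real x * order_coeff k lam x
     = lam * (\<Sum>j=1..k. real j * (if j \<le> x then order_coeff k lam (x - j) else 0))"
proof (cases x)
  case 0
  then show ?thesis by (simp add: sum.neutral)
next
  case (Suc n)
  let ?g = "\<Sum>j=1..k. fps_X ^ j :: real fps"
  have "fps_deriv (order_gf k lam) = fps_const lam * order_gf k lam * fps_deriv ?g"
    unfolding order_gf_def
    by (rule fps_deriv_exp_compose) (simp only: sum_fps_X_nth, simp)
  hence "fps_nth (fps_deriv (order_gf k lam)) n
      = lam * fps_nth (order_gf k lam * fps_deriv ?g) n"
    by (simp only: mult.assoc fps_mult_left_const_nth)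
  also have "fps_nth (order_gf k lam * fps_deriv ?g) n
      = fps_nth (fps_deriv ?g * order_gf k lam) n" by (simp only: mult.commute)
  also have "\<dots> = (\<Sum>i=0..n. real (Suc i) * (if Suc i \<le> k then 1 else 0) * order_coeff k lam (n - i))"
    unfolding fps_mult_nth fps_deriv_nth sum_fps_X_nth by simp
  also have "\<dots> = (\<Sum>j\<in>{1..Suc n}. real j * (if j \<le> k then 1 else 0) * order_coeff k lam (Suc n - j))"
    by (rule sum.reindex_bij_witness[of _ "\<lambda>j. j - 1" Suc]) auto
  also have "\<dots> = (\<Sum>j\<in>{1..k} \<inter> {1..Suc n}. real j * order_coeff k lam (Suc n - j))"
    by (rule sum.mono_neutral_cong_right) auto
  also have "\<dots> = (\<Sum>j=1..k. real j * (if j \<le> x then order_coeff k lam (x - j) else 0))"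
    by (rule sum.mono_neutral_cong_left) (auto simp: Suc)
  finally show ?thesis using Suc by (simp add: algebra_simps)
qed

text \<open>Dividing the recurrence by \<open>x > 0\<close> determines each value from the earlier
  ones, so a sequence is identified by checking the recurrence alone.\<close>

lemma order_coeff_unique:
  fixes f :: "nat \<Rightarrow> real"
  assumes f0: "f 0 = 1"
  and rec: "\<And>x. x > 0 \<Longrightarrow> real x * f x = lam * (\<Sum>j=1..k. real j * (if j \<le> x then f (x - j) else 0))"
  shows "f x = order_coeff k lam x"
proof (induction x rule: less_induct)
  case (less x)
  show ?case
  proof (cases "x = 0")
    case False
    have "(\<Sum>j=1..k. real j * (if j \<le> x then f (x - j) else 0))
        = (\<Sum>j=1..k. real j * (if j \<le> x then order_coeff k lam (x - j) else 0))"
      using less False by (intro sum.cong) auto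
    hence "real x * f x = real x * order_coeff k lam x"
      using rec[of x] False order_coeff_rec[of x k lam] by simp
    thus ?thesis using False by simp
  qed (simp add: f0)
qed

section \<open>The mass function as a coefficient sequence\<close>

definition tuples :: "nat \<Rightarrow> nat \<Rightarrow> (nat \<Rightarrow> nat) set" where
  "tuples k x = {xs \<in> {..<k} \<rightarrow>\<^sub>E UNIV. (\<Sum>i<k. (i + 1) * xs i) = x}"

lemma tuples_component_le:
  assumes "xs \<in> tuples k x" "i < k" shows "(i + 1) * xs i \<le> x"
proof -
  have "(i + 1) * xs i \<le> (\<Sum>i<k. (i + 1) * xs i)"
    by (rule member_le_sum[of i "{..<k}" "\<lambda>i. (i + 1) * xs i"]) (use assms in auto)
  thus ?thesis using assms(1) by (simp add: tuples_def)
qed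

text \<open>The bound \<open>{..x}\<close> follows from the weighted total. The unbounded form is
  easier to preserve when a component and \<open>x\<close> change together.\<close>

lemma tuples_bounded: "tuples k x = {xs \<in> {..<k} \<rightarrow>\<^sub>E {..x}. (\<Sum>i<k. (i + 1) * xs i) = x}"
proof (intro equalityI subsetI)
  fix xs assume xs: "xs \<in> tuples k x"
  have "xs i \<le> x" if "i < k" for i
    using tuples_component_le[OF xs that] by simp
  thus "xs \<in> {xs \<in> {..<k} \<rightarrow>\<^sub>E {..x}. (\<Sum>i<k. (i + 1) * xs i) = x}"
    using xs by (simp add: tuples_def PiE_iff)
next
  fix xs assume "xs \<in> {xs \<in> {..<k} \<rightarrow>\<^sub>E {..x}. (\<Sum>i<k. (i + 1) * xs i) = x}"
  thus "xs \<in> tuples k x" by (simp add: tuples_def PiE_iff)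
qed

lemma finite_tuples: "finite (tuples k x)"
  unfolding tuples_bounded
  by (rule finite_subset[of _ "{..<k} \<rightarrow>\<^sub>E {..x}"]) (auto intro: finite_PiE)

definition tuple_weight :: "nat \<Rightarrow> real \<Rightarrow> (nat \<Rightarrow> nat) \<Rightarrow> real" where
  "tuple_weight k lam xs = (\<Prod>i<k. lam ^ xs i / fact (xs i))"

lemma tuple_weight_upd:
  assumes "i < k"
  shows "real (Suc (xs i)) * tuple_weight k lam (xs(i := Suc (xs i))) = lam * tuple_weight k lam xs"
proof -
  have "tuple_weight k lam ys = lam ^ ys i / fact (ys i) * (\<Prod>j\<in>{..<k} - {i}. lam ^ ys j / fact (ys j))" for ys
    unfolding tuple_weight_def using assms by (subst prod.remove[of _ i]) auto
  note split = this[of xs] this[of "xs(i := Suc (xs i))"]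
  have "(\<Prod>j\<in>{..<k} - {i}. lam ^ (xs(i := Suc (xs i))) j / fact ((xs(i := Suc (xs i))) j))
      = (\<Prod>j\<in>{..<k} - {i}. lam ^ xs j / fact (xs j))"
    by (rule prod.cong) auto
  thus ?thesis unfolding split by (simp add: divide_simps)
qed

lemma sum_upd:
  fixes xs :: "nat \<Rightarrow> nat"
  assumes "i < k"
  shows "(\<Sum>j<k. (j + 1) * (xs(i := v)) j) + (i + 1) * xs i = (\<Sum>j<k. (j + 1) * xs j) + (i + 1) * v"
proof -
  have "(\<Sum>j<k. (j + 1) * ys j) = (i + 1) * ys i + (\<Sum>j\<in>{..<k} - {i}. (j + 1) * ys j)" for ys :: "nat \<Rightarrow> nat"
    using assms by (subst sum.remove[of _ i]) auto
  note this[of xs] this[of "xs(i := v)"]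
  moreover have "(\<Sum>j\<in>{..<k} - {i}. (j + 1) * (xs(i := v)) j) = (\<Sum>j\<in>{..<k} - {i}. (j + 1) * xs j)"
    by (rule sum.cong) auto
  ultimately show ?thesis by simp
qed

text \<open>Lowering component \<open>i\<close> by one is a bijection from the tuples of weighted
  total \<open>x\<close> with \<open>xs i > 0\<close> onto those of total
  \<open>x - (i + 1)\<close>; in the weights it trades the factor \<open>xs i\<close> for
  \<open>lam\<close>.\<close>

lemma tuple_weight_shift:
  assumes "i < k"
  shows "(\<Sum>xs\<in>tuples k x. real (xs i) * tuple_weight k lam xs)
    = lam * (if i + 1 \<le> x then \<Sum>xs\<in>tuples k (x - (i + 1)). tuple_weight k lam xs else 0)"
proof (cases "i + 1 \<le> x")
  case False
  have "real (xs i) * tuple_weight k lam xs = 0" if "xs \<in> tuples k x" for xs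
    using tuples_component_le[OF that assms] False by (cases "xs i") auto
  thus ?thesis using False by (simp add: sum.neutral)
next
  case True
  have "(\<Sum>xs\<in>tuples k x. real (xs i) * tuple_weight k lam xs)
      = (\<Sum>xs\<in>{xs \<in> tuples k x. 0 < xs i}. real (xs i) * tuple_weight k lam xs)"
    by (rule sum.mono_neutral_right) (auto simp: finite_tuples)
  also have "\<dots> = (\<Sum>xs\<in>tuples k (x - (i + 1)). lam * tuple_weight k lam xs)"
  proof (rule sum.reindex_bij_witness[of _ "\<lambda>ys. ys(i := Suc (ys i))" "\<lambda>xs. xs(i := xs i - 1)"])
    fix xs assume xs: "xs \<in> {xs \<in> tuples k x. 0 < xs i}"
    show "(xs(i := xs i - 1))(i := Suc ((xs(i := xs i - 1)) i)) = xs" using xs by auto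
    have "(i + 1) * xs i = (i + 1) * (xs i - 1) + (i + 1)" using xs by (cases "xs i") auto
    thus "xs(i := xs i - 1) \<in> tuples k (x - (i + 1))"
      using xs assms sum_upd[OF assms, of xs "xs i - 1"] by (auto simp: tuples_def PiE_def extensional_def)
    show "lam * tuple_weight k lam (xs(i := xs i - 1)) = real (xs i) * tuple_weight k lam xs"
      using tuple_weight_upd[OF assms, of "xs(i := xs i - 1)" lam] xs by simp
  next
    fix ys assume ys: "ys \<in> tuples k (x - (i + 1))"
    show "(ys(i := Suc (ys i)))(i := (ys(i := Suc (ys i))) i - 1) = ys" by auto
    show "ys(i := Suc (ys i)) \<in> {xs \<in> tuples k x. 0 < xs i}"
      using ys assms True sum_upd[OF assms, of ys "Suc (ys i)"]
      by (auto simp: tuples_def PiE_def extensional_def)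
  qed
  finally show ?thesis using True by (simp add: sum_distrib_left)
qed

text \<open>Replace the factor \<open>x\<close> by the weighted total of each tuple, exchange the
  sums and shift each component separately.\<close>

lemma tuple_weight_rec:
  "real x * (\<Sum>xs\<in>tuples k x. tuple_weight k lam xs)
    = lam * (\<Sum>j=1..k. real j * (if j \<le> x then \<Sum>xs\<in>tuples k (x - j). tuple_weight k lam xs else 0))"
proof -
  have "real x * (\<Sum>xs\<in>tuples k x. tuple_weight k lam xs)
      = (\<Sum>xs\<in>tuples k x. \<Sum>i<k. real (i + 1) * (real (xs i) * tuple_weight k lam xs))"
    unfolding sum_distrib_left
  proof (rule sum.cong)
    fix xs assume "xs \<in> tuples k x"
    hence "real x = real (\<Sum>i<k. (i + 1) * xs i)" by (simp add: tuples_def)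
    hence "real x = (\<Sum>i<k. real (i + 1) * real (xs i))" by (simp only: of_nat_sum of_nat_mult)
    thus "real x * tuple_weight k lam xs = (\<Sum>i<k. real (i + 1) * (real (xs i) * tuple_weight k lam xs))"
      by (simp only: sum_distrib_right mult.assoc)
  qed simp
  also have "\<dots> = (\<Sum>i<k. real (i + 1) * (\<Sum>xs\<in>tuples k x. real (xs i) * tuple_weight k lam xs))"
    by (subst sum.swap) (simp only: sum_distrib_left)
  also have "\<dots> = (\<Sum>i<k. real (i + 1) * (lam * (if i + 1 \<le> x then \<Sum>xs\<in>tuples k (x - (i + 1)). tuple_weight k lam xs else 0)))"
    by (intro sum.cong refl arg_cong2[where f = "(*)"] tuple_weight_shift) auto
  also have "\<dots> = (\<Sum>j=1..k. real j * (lam * (if j \<le> x then \<Sum>xs\<in>tuples k (x - j). tuple_weight k lam xs else 0)))"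
    by (rule sum.reindex_bij_witness[of _ "\<lambda>j. j - 1" Suc]) auto
  finally show ?thesis by (simp add: sum_distrib_left mult_ac)
qed

lemma tuples_0: "tuples k 0 = {\<lambda>i\<in>{..<k}. 0}"
proof -
  have "xs = (\<lambda>i\<in>{..<k}. 0)" if "xs \<in> tuples k 0" for xs
    using tuples_component_le[OF that] that by (auto simp: tuples_def PiE_def extensional_def fun_eq_iff)
  moreover have "(\<lambda>i\<in>{..<k}. 0) \<in> tuples k 0" by (auto simp: tuples_def)
  ultimately show ?thesis by blast
qed

lemma poisson_order_pmf_eq:
  "poisson_order_pmf k lam x = exp (- real k * lam) * order_coeff k lam x"
proof -
  have "(\<Sum>xs\<in>tuples k x. tuple_weight k lam xs) = order_coeff k lam x"
  proof (rule order_coeff_unique[where f = "\<lambda>x. \<Sum>xs\<in>tuples k x. tuple_weight k lam xs"])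
    show "(\<Sum>xs\<in>tuples k 0. tuple_weight k lam xs) = 1"
      by (simp add: tuples_0 tuple_weight_def)
  qed (rule tuple_weight_rec)
  thus ?thesis
    unfolding poisson_order_pmf_def tuples_bounded[symmetric] tuple_weight_def
    by (simp add: power_sum prod_dividef sum_distrib_left[symmetric] flip: times_divide_eq_right)
qed

lemma order_coeff_nonneg: "lam \<ge> 0 \<Longrightarrow> order_coeff k lam x \<ge> 0"
proof (induction x rule: less_induct)
  case (less x)
  have "real x * order_coeff k lam x \<ge> 0"
    unfolding order_coeff_rec
    using less by (intro mult_nonneg_nonneg sum_nonneg) (auto simp: not_le)
  thus ?case by (cases "x = 0") (auto simp: zero_le_mult_iff)
qed

lemma order_coeff_pos:
  assumes "lam > 0" "k \<ge> 1" shows "order_coeff k lam x > 0"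
proof (induction x rule: less_induct)
  case (less x)
  show ?case
  proof (cases "x = 0")
    case False
    have "0 < (\<Sum>j=1..k. real j * (if j \<le> x then order_coeff k lam (x - j) else 0))"
      by (rule sum_pos2[of _ 1]) (use False assms less in \<open>auto simp: order_coeff_nonneg\<close>)
    hence "0 < real x * order_coeff k lam x"
      unfolding order_coeff_rec using assms by simp
    thus ?thesis using False by (simp add: zero_less_mult_iff)
  qed simp
qed

section \<open>Sign certificates for the differences\<close>

fun dot :: "int list \<Rightarrow> (nat \<Rightarrow> real) \<Rightarrow> nat \<Rightarrow> real" where
  "dot [] f n = 0"
| "dot (c # cs) f n = of_int c * f n + dot cs f (Suc n)"

fun add_list :: "int list \<Rightarrow> int list \<Rightarrow> int list" where
  "add_list [] ys = ys"
| "add_list (x # xs) [] = x # xs"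
| "add_list (x # xs) (y # ys) = (x + y) # add_list xs ys"

text \<open>Multiplication of coefficient lists read as polynomials; it corresponds to applying two
  filters in succession.\<close>

fun conv_list :: "int list \<Rightarrow> int list \<Rightarrow> int list" where
  "conv_list cs [] = []"
| "conv_list cs (p # ps) = add_list (map ((*) p) cs) (0 # conv_list cs ps)"

fun index_weights :: "int \<Rightarrow> int list \<Rightarrow> int list" where
  "index_weights i [] = []"
| "index_weights i (p # ps) = p * i # index_weights (i + 1) ps"

fun tail_sums :: "int list \<Rightarrow> int list" where
  "tail_sums [] = []"
| "tail_sums (q # qs) = sum_list qs # tail_sums qs"

lemma dot_add_list: "dot (add_list xs ys) f n = dot xs f n + dot ys f n"
  by (induction xs ys arbitrary: n rule: add_list.induct) (auto simp: algebra_simps)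

lemma dot_map_mult: "dot (map ((*) c) xs) f n = of_int c * dot xs f n"
  by (induction xs arbitrary: n) (auto simp: algebra_simps)

lemma dot_conv_list: "dot (conv_list cs ps) f n = dot ps (dot cs f) n"
  by (induction ps arbitrary: n) (auto simp: dot_add_list dot_map_mult)

lemma dot_index_weights:
  "dot (index_weights (i + int n) ps) f n = dot ps (\<lambda>n. of_int (i + int n) * f n) n"
proof (induction ps arbitrary: n)
  case (Cons p ps)
  have "i + int n + 1 = i + int (Suc n)" by simp
  thus ?case using Cons[of "Suc n"] by (simp only: index_weights.simps dot.simps of_int_mult mult_ac)
qed simp

text \<open>Each later value is \<open>f n\<close> minus the differences in between, so a difference
  is counted once for every entry of \<open>qs\<close> behind it.\<close>

lemma dot_by_parts:
  "dot qs f n = of_int (sum_list qs) * f n - dot (tail_sums qs) (\<lambda>n. f n - f (Suc n)) n"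
  by (induction qs arbitrary: n) (auto simp: algebra_simps)

lemma dot_nonpos:
  assumes "list_all (\<lambda>c. c \<le> 0) cs" "\<And>m. m \<ge> n \<Longrightarrow> f m \<ge> 0"
  shows "dot cs f n \<le> 0"
  using assms
proof (induction cs arbitrary: n)
  case (Cons c cs)
  have "of_int c * f n \<le> 0" using Cons.prems by (intro mult_nonpos_nonneg) auto
  moreover have "dot cs f (Suc n) \<le> 0" using Cons by auto
  ultimately show ?case by simp
qed simp

text \<open>With \<open>d n = a n - a (n + 1)\<close>, summation by parts turns
  \<open>(lam * (k * (k + 1) / 2) - (i + n)) * a n = lam * (\<Sum>j=1..k. j * a (n + j))\<close> into
  \<open>lam * dot (kernel k) d n = (i + n) * a n\<close>. Combining these with the coefficients \<open>ps\<close> and expanding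
  each \<open>a n\<close> as \<open>a 0 - (d 0 + \<dots> + d (n - 1))\<close> gives \<open>dot (lam R + T) d 0 = S * a 0\<close>, where
  \<open>R = conv_list (kernel k) ps\<close>, \<open>T = tail_sums (index_weights i ps)\<close> and \<open>S = sum_list (index_weights i ps)\<close>.
  The certificate makes all coefficients but the first nonpositive and \<open>S\<close> positive for every
  \<open>lam \<ge> L\<close>, so \<open>d 0\<close> has the sign \<open>s\<close> of the first coefficient.\<close>

definition kernel :: "nat \<Rightarrow> int list" where
  "kernel k = tail_sums [0..int k]"

definition sign_cert :: "nat \<Rightarrow> int \<Rightarrow> int \<Rightarrow> int list \<Rightarrow> int \<Rightarrow> bool" where
  "sign_cert k L s ps i =
    (case conv_list (kernel k) ps of [] \<Rightarrow> False | r # rs \<Rightarrow>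
     (case add_list (map ((*) L) (conv_list (kernel k) ps)) (tail_sums (index_weights i ps)) of
        [] \<Rightarrow> False
      | e # es \<Rightarrow> sum_list (index_weights i ps) > 0 \<and> s * r \<ge> 0 \<and> s * e > 0
          \<and> list_all (\<lambda>c. c \<le> 0) rs \<and> list_all (\<lambda>c. c \<le> 0) es))"

lemma sign_cert_sound:
  fixes a :: "nat \<Rightarrow> real" and lam :: real
  assumes cert: "sign_cert k L s ps i"
  and L: "of_int L \<le> lam"
  and rec: "\<And>n. (lam * of_int (sum_list [0..int k]) - of_int (i + int n)) * a n = lam * dot [0..int k] a n"
  and pos: "a 0 > 0"
  and mono: "\<And>n. n \<ge> 1 \<Longrightarrow> a (Suc n) \<le> a n"
  shows "of_int s * (a 0 - a 1) > 0"
proof -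
  define d where "d = (\<lambda>n. a n - a (Suc n))"
  define R where "R = conv_list (kernel k) ps"
  define T where "T = tail_sums (index_weights i ps)"
  obtain r rs e es where re: "R = r # rs" "add_list (map ((*) L) R) T = e # es"
    and S: "sum_list (index_weights i ps) > 0" and sr: "s * r \<ge> 0" and se: "s * e > 0"
    and rs: "list_all (\<lambda>c. c \<le> 0) rs" and es: "list_all (\<lambda>c. c \<le> 0) es"
    using cert unfolding sign_cert_def R_def[symmetric] T_def[symmetric]
    by (auto split: list.splits)
  have D: "lam * dot (kernel k) d n = of_int (i + int n) * a n" for n
    using rec[of n] dot_by_parts[of "[0..int k]" a n]
    unfolding kernel_def d_def by (simp add: algebra_simps)
  have scale: "lam * dot ps f n = dot ps (\<lambda>n. lam * f n) n" for f n
    by (induction ps arbitrary: n) (auto simp: algebra_simps)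
  have "lam * dot R d 0 = dot ps (\<lambda>n. of_int (i + int n) * a n) 0"
    unfolding R_def dot_conv_list scale D ..
  also have "\<dots> = dot (index_weights i ps) a 0"
    using dot_index_weights[of i 0 ps a] by simp
  also have "\<dots> = of_int (sum_list (index_weights i ps)) * a 0 - dot T d 0"
    unfolding T_def d_def by (rule dot_by_parts)
  also have "\<dots> > - dot T d 0" using S pos by simp
  \<comment> \<open>Since \<open>lam R + T = (lam - L) R + (L R + T)\<close> with
    \<open>lam - L \<ge> 0\<close>, signs of \<open>R\<close> and of the combination at
    \<open>L\<close> settle every larger \<open>lam\<close>.\<close>
  finally have "(lam - of_int L) * dot R d 0 + dot (add_list (map ((*) L) R) T) d 0 > 0"
    by (simp add: dot_add_list dot_map_mult algebra_simps)
  hence *: "(lam - of_int L) * (of_int r * d 0 + dot rs d 1) + (of_int e * d 0 + dot es d 1) > 0"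
    unfolding re(2) unfolding re(1) by simp
  have "dot rs d 1 \<le> 0" "dot es d 1 \<le> 0"
    using mono by (auto intro!: dot_nonpos rs es simp: d_def)
  hence "(lam - of_int L) * dot rs d 1 + dot es d 1 \<le> 0"
    using L by (simp add: add_nonpos_nonpos mult_nonneg_nonpos)
  with * have **: "((lam - of_int L) * of_int r + of_int e) * d 0 > 0"
    by (simp add: algebra_simps)
  have "of_int s * ((lam - of_int L) * of_int r + of_int e)
      = (lam - of_int L) * of_int (s * r) + (of_int (s * e) :: real)"
    by (simp add: algebra_simps)
  also have "\<dots> > 0"
    using L sr se by (intro add_nonneg_pos mult_nonneg_nonneg) (auto simp flip: of_int_mult)
  finally have "of_int s * ((lam - of_int L) * of_int r + of_int e) > 0" .
  with ** have "of_int s * d 0 > 0"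
    by (smt (verit) mult_less_0_iff zero_less_mult_iff)
  thus ?thesis by (simp add: d_def)
qed

text \<open>Extending by 0 keeps the recurrence valid at all indices: both sides vanish for \<open>n > x\<close>.\<close>

definition rev_coeff :: "nat \<Rightarrow> real \<Rightarrow> nat \<Rightarrow> nat \<Rightarrow> real" where
  "rev_coeff k lam x n = (if n \<le> x then order_coeff k lam (x - n) else 0)"

lemma dot_upto: "dot [0..int k] f n = (\<Sum>j=1..k. real j * f (n + j))"
proof -
  \<comment> \<open>The lower end \<open>m\<close> is generalised for the induction; afterwards the
    term \<open>j = 0\<close> vanishes.\<close>
  have "dot [int m..int m + int l] f n = (\<Sum>j=m..m+l. real j * f (n + j - m))" for m l n
  proof (induction l arbitrary: m n)
    case (Suc l)
    have "[int m..int m + int (Suc l)] = int m # [int (Suc m)..int (Suc m) + int l]"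
      by (subst upto_rec1) (auto simp: algebra_simps)
    hence "dot [int m..int m + int (Suc l)] f n
        = real m * f n + (\<Sum>j=Suc m..Suc m+l. real j * f (Suc n + j - Suc m))"
      using Suc[of "Suc m" "Suc n"] by simp
    also have "\<dots> = (\<Sum>j=m..m+Suc l. real j * f (n + j - m))"
      by (subst sum.atLeast_Suc_atMost[of m]) auto
    finally show ?case .
  qed simp
  from this[of 0 k n] show ?thesis
    by (simp add: sum.atLeast_Suc_atMost)
qed

lemma sum_list_upto: "sum_list [0..int k] = int (k * (k + 1) div 2)"
proof -
  have "2 * sum_list [0..int k] = int (k * (k + 1))"
  proof (induction k)
    case (Suc k)
    have "[0..int (Suc k)] = [0..int k] @ [int (Suc k)]"
      by (subst upto_rec2) (auto simp: algebra_simps)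
    thus ?case using Suc by (simp add: algebra_simps)
  qed simp
  thus ?thesis by linarith
qed

lemma rev_coeff_rec:
  assumes "x + i = lam * (k * (k + 1) div 2)"
  shows "(real lam * of_int (sum_list [0..int k]) - of_int (int i + int n)) * rev_coeff k (real lam) x n
    = real lam * dot [0..int k] (rev_coeff k (real lam) x) n"
proof -
  have "real lam * of_int (sum_list [0..int k]) - of_int (int i + int n) = real x - real n"
    using arg_cong[OF assms, of real] by (simp add: sum_list_upto)
  moreover have "(real x - real n) * rev_coeff k (real lam) x n
      = real lam * dot [0..int k] (rev_coeff k (real lam) x) n"
  proof (cases "n \<le> x")
    case True
    have "(\<Sum>j=1..k. real j * rev_coeff k (real lam) x (n + j))
        = (\<Sum>j=1..k. real j * (if j \<le> x - n then order_coeff k (real lam) (x - n - j) else 0))"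
      using True by (intro sum.cong) (auto simp: rev_coeff_def)
    thus ?thesis
      using True order_coeff_rec[of "x - n" k "real lam"]
      by (simp add: dot_upto rev_coeff_def of_nat_diff)
  qed (simp add: rev_coeff_def dot_upto sum.neutral)
  ultimately show ?thesis by (simp only:)
qed

text \<open>Only ascents strictly below \<open>x\<close> are assumed, so this can drive an induction
  on \<open>x\<close>: \<open>s = 1\<close> yields an ascent at \<open>x\<close>,
  \<open>s = -1\<close> a descent.\<close>

lemma order_coeff_sign:
  assumes "sign_cert k L s ps (int i)" "of_int L \<le> real lam" "lam \<ge> 1" "k \<ge> 1"
  and x: "x + i = lam * (k * (k + 1) div 2)" "x \<ge> 1"
  and mono: "\<And>y. 1 \<le> y \<Longrightarrow> y < x \<Longrightarrow> order_coeff k (real lam) (y - 1) \<le> order_coeff k (real lam) y"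
  shows "of_int s * (order_coeff k (real lam) x - order_coeff k (real lam) (x - 1)) > 0"
proof -
  have "rev_coeff k (real lam) x (Suc n) \<le> rev_coeff k (real lam) x n" if "n \<ge> 1" for n
  proof (cases "n < x")
    case True
    thus ?thesis using mono[of "x - n"] that by (simp add: rev_coeff_def)
  next
    case False
    thus ?thesis by (simp add: rev_coeff_def order_coeff_nonneg)
  qed
  moreover have "rev_coeff k (real lam) x 0 > 0"
    using assms(3,4) order_coeff_pos[of "real lam" k x] by (simp add: rev_coeff_def)
  ultimately have "of_int s * (rev_coeff k (real lam) x 0 - rev_coeff k (real lam) x 1) > 0"
    by (intro sign_cert_sound[OF assms(1,2) rev_coeff_rec[OF x(1)]]) auto
  thus ?thesis using x(2) by (simp add: rev_coeff_def)
qed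

section \<open>Monotonicity under an increase of the parameter\<close>

lemma order_coeff_add_mono:
  assumes mono: "\<And>y. 1 \<le> y \<Longrightarrow> y \<le> m \<Longrightarrow> order_coeff k a (y - 1) \<le> order_coeff k a y"
  and "b \<ge> 0" "1 \<le> x" "x \<le> m"
  shows "order_coeff k (a + b) (x - 1) \<le> order_coeff k (a + b) x"
proof -
  have conv: "order_coeff k (a + b) y = (\<Sum>j=0..y. order_coeff k b j * order_coeff k a (y - j))" for y
    unfolding order_gf_add mult.commute[of "order_gf k a"] fps_mult_nth ..
  have "order_coeff k (a + b) (x - 1)
      = (\<Sum>j=0..x - 1. order_coeff k b j * order_coeff k a (x - 1 - j))" by (rule conv)
  also have "\<dots> \<le> (\<Sum>j=0..x - 1. order_coeff k b j * order_coeff k a (x - j))"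
  proof (intro sum_mono mult_left_mono order_coeff_nonneg assms)
    fix j assume "j \<in> {0..x - 1}"
    thus "order_coeff k a (x - 1 - j) \<le> order_coeff k a (x - j)"
      using mono[of "x - j"] assms by (simp add: diff_right_commute)
  qed
  also have "\<dots> \<le> (\<Sum>j=0..x. order_coeff k b j * order_coeff k a (x - j))"
  proof (rule sum_mono2)
    fix j assume "j \<in> {0..x} - {0..x - 1}"
    thus "order_coeff k b j * order_coeff k a (x - j) \<ge> 0"
      using assms by (auto simp: order_coeff_nonneg dest: le_antisym)
  qed auto
  also have "\<dots> = order_coeff k (a + b) x" by (rule conv[symmetric])
  finally show ?thesis .
qed

text \<open>The coefficient lists below are rounded solutions of the linear programs given by \<open>sign_cert\<close>;
  each is paired with the list of distances \<open>i = N - x\<close> it serves.\<close>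

definition threshold :: "nat \<Rightarrow> int" where
  "threshold k = (if k = 5 then 7 else 10)"

definition rising_certs :: "nat \<Rightarrow> (int list \<times> int list) list" where
  "rising_certs k =
    (if k = 2 then
       [([1..3], [1500, -1060, 706, -498, 332, -234, 156, -104, -1])]
     else if k = 3 then
       [([1], [200000, -168969, 40532, 50707, -64819, 28661, 8524, -22927, 14843, -906, -7450,
               6661, -1826, -2159, 2712, -1181, -502, 1008, -610, -25, 325, -274, 65, 62, -86]),
        ([2..6], [500, -432, 109, 124, -168, 77, 19, -59, 39, -4, -18])]
     else if k = 4 then
       [([2..11], [200000, -185357, 24672, 27545, 17596, -48381, 20207, 8641, -2570, -13389,
                   10392, 1047, -3322, -2397, 4063, -651, -1301])]
     else
       [([2, 3], [300000, -282954, 22193, 25192, 28505, 34243, -80091, 21047, 14380, 6380, -3391,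
                   -19127, 11942, 4062, -1987, -2270, -3223, 4661, 251, -1274, -737]),
        ([4..16], [2000, -1925, 167, 183, 183, -40, -309, 148, 72, 13, -73, -47, 70, 11, -40])])"

text \<open>Serves the single distance 1, the step from \<open>m\<close> to
  \<open>m + 1 = N - 1\<close>. The leading entry is negative, which makes the coefficient of
  \<open>d 0\<close> negative.\<close>

definition falling_cert :: "nat \<Rightarrow> int list" where
  "falling_cert k =
    (if k = 4 then
       [-40000, 36000, -4400, -5264, -6954, 11703, -3560, -2311, -235, 3252, -1841, -600, 521,
        687, -769, -28, 288, 67, -271, 77, 93, -30, -80, 55, 18, -23, -17, 23, -14]
     else
       [-70000, 65333, -4978, -5621, -6744, -8597, 18450, -4423, -3226, -1808, 691, 4211, -2323,
        -1038, -48, 865, -633])"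

fun valid_rising_cert :: "nat \<Rightarrow> int list \<times> int list \<Rightarrow> bool" where
  "valid_rising_cert k (is, ps) = list_all (sign_cert k (threshold k) 1 ps) is"

lemma rising_certs_valid:
  "list_all (valid_rising_cert 2) (rising_certs 2)" "list_all (valid_rising_cert 3) (rising_certs 3)"
  "list_all (valid_rising_cert 4) (rising_certs 4)" "list_all (valid_rising_cert 5) (rising_certs 5)"
  by code_simp+

lemma falling_cert_valid:
  "sign_cert 4 (threshold 4) (-1) (falling_cert 4) 1" "sign_cert 5 (threshold 5) (-1) (falling_cert 5) 1"
  by code_simp+

text \<open>These distances \<open>i = N - x\<close> are exactly those of the
  \<open>k * (k + 1) div 2\<close> indices between two consecutive modes, the upper mode
  included.\<close>

lemma rising_cert_exists:
  assumes k: "k \<in> {2, 3, 4, 5}" and i: "k div 2 \<le> i" "i < k div 2 + k * (k + 1) div 2"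
  obtains ps where "sign_cert k (threshold k) 1 ps (int i)"
proof -
  have "int i \<in> (\<Union>(is, ps)\<in>set (rising_certs k). set is)"
    using k i by (auto simp: rising_certs_def) presburger+
  then obtain "is" ps where "(is, ps) \<in> set (rising_certs k)" "int i \<in> set is" by auto
  moreover have "list_all (valid_rising_cert k) (rising_certs k)"
    using rising_certs_valid k by auto
  ultimately have "sign_cert k (threshold k) 1 ps (int i)"
    by (force simp: list_all_iff)
  thus thesis by (rule that)
qed

section \<open>Small parameters\<close>

fun weighted_sum :: "int \<Rightarrow> int list \<Rightarrow> int" where
  "weighted_sum j [] = 0"
| "weighted_sum j (x # xs) = j * x + weighted_sum (j + 1) xs"

text \<open>The recurrence cleared of denominators: with \<open>n\<close> the new index, the old
  entries are multiplied by \<open>n\<close> instead of dividing the new one.\<close>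

definition next_window :: "int \<Rightarrow> int \<Rightarrow> int list \<Rightarrow> int list" where
  "next_window lam n w = lam * weighted_sum 1 w # map ((*) n) (butlast w)"

text \<open>The windows list the integers \<open>x! * order_coeff k lam (x - j)\<close> for \<open>j < k\<close>;
  an empty result of \<open>climb\<close> signals a descent on the way.\<close>

fun climb :: "int \<Rightarrow> int list \<Rightarrow> int list \<Rightarrow> int list"
and climb_check :: "int \<Rightarrow> int list \<Rightarrow> int list \<Rightarrow> int list" where
  "climb lam [] w = w"
| "climb lam (n # ns) w = climb_check lam ns (next_window lam n w)"
| "climb_check lam ns [] = []"
| "climb_check lam ns [a] = []"
| "climb_check lam ns (a # b # w) = (if b \<le> a then climb lam ns (a # b # w) else [])"

definition head_less :: "int list \<Rightarrow> bool" where
  "head_less w = (case w of a # b # _ \<Rightarrow> a < b | _ \<Rightarrow> False)"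

definition head_greater :: "int list \<Rightarrow> bool" where
  "head_greater w = (case w of a # b # _ \<Rightarrow> b < a | _ \<Rightarrow> False)"

definition peak_final :: "nat \<Rightarrow> int \<Rightarrow> int \<Rightarrow> int list \<Rightarrow> bool" where
  "peak_final k lam m w \<longleftrightarrow> head_greater w \<and> (4 \<le> k \<longrightarrow> head_less (next_window lam (m + 1) w))"

definition peak_from :: "nat \<Rightarrow> int \<Rightarrow> int \<Rightarrow> bool" where
  "peak_from k lam m \<longleftrightarrow> peak_final k lam m (climb lam [1..m] (1 # replicate (k - 1) 0))"

definition peak_test :: "nat \<Rightarrow> int \<Rightarrow> bool" where
  "peak_test k lam \<longleftrightarrow> peak_from k lam (lam * sum_list [0..int k] - int (k div 2))"

definition is_window :: "nat \<Rightarrow> real \<Rightarrow> nat \<Rightarrow> int list \<Rightarrow> bool" where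
  "is_window k lam x w \<longleftrightarrow>
    length w = k \<and> (\<forall>j<k. of_int (w ! j) = fact x * rev_coeff k lam x j)"

lemma weighted_sum_eq: "weighted_sum c w = (\<Sum>j<length w. (c + int j) * w ! j)"
proof (induction w arbitrary: c)
  case (Cons x xs)
  have "(\<Sum>j<length (x # xs). (c + int j) * (x # xs) ! j)
      = c * x + (\<Sum>j<length xs. (c + 1 + int j) * xs ! j)"
    by (simp only: length_Cons sum.lessThan_Suc_shift) (simp add: algebra_simps)
  thus ?case using Cons by simp
qed simp

lemma is_window_next:
  assumes "is_window k (of_int lam) x w" "k \<ge> 1" "n = int (Suc x)"
  shows "is_window k (of_int lam) (Suc x) (next_window lam n w)"
proof -
  let ?A = "order_coeff k (of_int lam)"
  have len: "length w = k" and w: "\<And>j. j < k \<Longrightarrow> of_int (w ! j) = fact x * rev_coeff k (of_int lam) x j"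
    using assms by (auto simp: is_window_def)
  have "of_int (lam * weighted_sum 1 w)
      = of_int lam * (\<Sum>j<k. real (Suc j) * (fact x * rev_coeff k (of_int lam) x j))"
    by (simp add: weighted_sum_eq len w del: of_nat_Suc) (simp add: algebra_simps)
  also have "\<dots> = fact x * (of_int lam * (\<Sum>j<k. real (Suc j) * rev_coeff k (of_int lam) x j))"
    by (simp add: sum_distrib_left mult_ac)
  also have "(\<Sum>j<k. real (Suc j) * rev_coeff k (of_int lam) x j)
      = (\<Sum>j=1..k. real j * (if j \<le> Suc x then ?A (Suc x - j) else 0))"
    by (rule sum.reindex_bij_witness[of _ "\<lambda>j. j - 1" Suc]) (auto simp: rev_coeff_def)
  also have "of_int lam * \<dots> = real (Suc x) * ?A (Suc x)"
    by (rule order_coeff_rec[symmetric])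
  finally have head: "of_int (lam * weighted_sum 1 w) = fact (Suc x) * ?A (Suc x)"
    by (simp add: algebra_simps)
  have "of_int (next_window lam n w ! j) = fact (Suc x) * rev_coeff k (of_int lam) (Suc x) j" if "j < k" for j
  proof (cases j)
    case 0
    thus ?thesis using head by (simp add: next_window_def rev_coeff_def)
  next
    case (Suc i)
    thus ?thesis using w[of i] that len assms(3)
      by (simp add: next_window_def rev_coeff_def nth_butlast algebra_simps)
  qed
  moreover have "length (next_window lam n w) = k"
    using len assms by (simp add: next_window_def)
  ultimately show ?thesis by (simp add: is_window_def)
qed

lemma is_window_compare:
  assumes "is_window k lam (Suc x) (a # b # w)"
  shows "b \<le> a \<longleftrightarrow> order_coeff k lam x \<le> order_coeff k lam (Suc x)"
    and "b < a \<longleftrightarrow> order_coeff k lam x < order_coeff k lam (Suc x)"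
    and "a < b \<longleftrightarrow> order_coeff k lam (Suc x) < order_coeff k lam x"
proof -
  have k: "k \<ge> 2" using assms by (auto simp: is_window_def)
  have ab: "of_int a = fact (Suc x) * order_coeff k lam (Suc x)" "of_int b = fact (Suc x) * order_coeff k lam x"
    using assms k unfolding is_window_def by (force simp: rev_coeff_def simp del: fact_Suc)+
  have "b \<le> a \<longleftrightarrow> of_int b \<le> (of_int a :: real)" "b < a \<longleftrightarrow> of_int b < (of_int a :: real)"
    "a < b \<longleftrightarrow> of_int a < (of_int b :: real)" by simp_all
  thus "b \<le> a \<longleftrightarrow> order_coeff k lam x \<le> order_coeff k lam (Suc x)"
    and "b < a \<longleftrightarrow> order_coeff k lam x < order_coeff k lam (Suc x)"
    and "a < b \<longleftrightarrow> order_coeff k lam (Suc x) < order_coeff k lam x"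
    unfolding ab by (simp_all del: fact_Suc)
qed

lemma climb_sound:
  assumes "is_window k (of_int lam) x w" "k \<ge> 1"
    and "climb lam [int (Suc x)..int (x + l)] w \<noteq> []"
  shows "is_window k (of_int lam) (x + l) (climb lam [int (Suc x)..int (x + l)] w)
    \<and> (\<forall>y. x < y \<and> y \<le> x + l \<longrightarrow> order_coeff k (of_int lam) (y - 1) \<le> order_coeff k (of_int lam) y)"
  using assms
proof (induction l arbitrary: x w)
  case (Suc l)
  let ?w = "next_window lam (int (Suc x)) w" and ?ns = "[int (Suc (Suc x))..int (Suc x + l)]"
  have up: "[int (Suc x)..int (x + Suc l)] = int (Suc x) # ?ns"
    by (subst upto_rec1) (auto simp: algebra_simps)
  have w: "is_window k (of_int lam) (Suc x) ?w"
    using Suc.prems by (intro is_window_next) auto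
  obtain a b v where v: "?w = a # b # v" "b \<le> a"
    and c: "climb lam [int (Suc x)..int (x + Suc l)] w = climb lam ?ns ?w"
    using Suc.prems(3) unfolding up climb.simps
    by (cases "(lam, ?ns, ?w)" rule: climb_check.cases) (auto split: if_splits)
  have IH: "is_window k (of_int lam) (Suc x + l) (climb lam ?ns ?w)
    \<and> (\<forall>y. Suc x < y \<and> y \<le> Suc x + l \<longrightarrow> order_coeff k (of_int lam) (y - 1) \<le> order_coeff k (of_int lam) y)"
    using Suc.prems(3) unfolding c by (intro Suc.IH w Suc.prems)
  have "order_coeff k (of_int lam) x \<le> order_coeff k (of_int lam) (Suc x)"
    using is_window_compare(1)[of k "of_int lam" x a b v] w v by simp
  hence "order_coeff k (of_int lam) (y - 1) \<le> order_coeff k (of_int lam) y" if "x < y" "y \<le> x + Suc l" for y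
    using IH that by (cases "y = Suc x") auto
  thus ?case using IH unfolding c by simp
qed simp

definition mode_index :: "nat \<Rightarrow> nat \<Rightarrow> nat" where
  "mode_index k lam = lam * (k * (k + 1) div 2) - k div 2"

text \<open>For \<open>k = 2\<close> and \<open>k = 3\<close> the index after \<open>m\<close> is
  already \<open>N\<close>, where the averaging argument takes over; only larger \<open>k\<close>
  call for the descent.\<close>

definition peaked :: "nat \<Rightarrow> nat \<Rightarrow> bool" where
  "peaked k lam \<longleftrightarrow>
    (\<forall>y. 1 \<le> y \<and> y \<le> mode_index k lam \<longrightarrow> order_coeff k (real lam) (y - 1) \<le> order_coeff k (real lam) y)
    \<and> order_coeff k (real lam) (mode_index k lam - 1) < order_coeff k (real lam) (mode_index k lam)
    \<and> (k \<ge> 4 \<longrightarrow> order_coeff k (real lam) (mode_index k lam + 1) < order_coeff k (real lam) (mode_index k lam))"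

lemma peak_test_sound:
  assumes "peak_test k (int l)" "k \<ge> 1" "l \<ge> 1"
  shows "peaked k l"
proof -
  let ?w0 = "1 # replicate (k - 1) 0"
  define m where "m = mode_index k l"
  define w where "w = climb (int l) [1..int m] ?w0"
  \<comment> \<open>This makes the subtraction of \<open>k div 2\<close> exact and the mode
    positive.\<close>
  have "k \<le> k * (k + 1) div 2" using div_le_mono[of "k * 2" "k * (k + 1)" 2] assms(2) by simp
  also have "\<dots> \<le> l * (k * (k + 1) div 2)" using assms(3) by simp
  finally have m: "m \<ge> 1" "int m = int l * sum_list [0..int k] - int (k div 2)"
    using assms(2) by (auto simp: m_def mode_index_def sum_list_upto simp flip: of_nat_mult of_nat_diff)
  have w0: "is_window k (of_int (int l)) 0 ?w0"
    using assms(2) by (auto simp: is_window_def rev_coeff_def nth_Cons split: nat.splits)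
  have t: "head_greater w" "k \<ge> 4 \<Longrightarrow> head_less (next_window (int l) (int m + 1) w)"
    using assms(1) unfolding peak_test_def m(2)[symmetric] peak_from_def peak_final_def w_def by auto
  have "w \<noteq> []" using t(1) by (auto simp: head_greater_def)
  hence c: "is_window k (of_int (int l)) m w"
    "\<And>y. 0 < y \<Longrightarrow> y \<le> m \<Longrightarrow> order_coeff k (real l) (y - 1) \<le> order_coeff k (real l) y"
    using climb_sound[OF w0 assms(2), of m] by (simp_all add: w_def)
  have "is_window k (of_int (int l)) (Suc (m - 1)) w" using c(1) m(1) by simp
  hence "order_coeff k (real l) (m - 1) < order_coeff k (real l) m"
    using t(1) is_window_compare(2)[of k "of_int (int l)" "m - 1"] m(1)
    by (auto simp: head_greater_def split: list.splits)
  moreover have "order_coeff k (real l) (m + 1) < order_coeff k (real l) m" if "k \<ge> 4"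
    using t(2)[OF that] is_window_compare(3)[of k "of_int (int l)" m]
      is_window_next[OF c(1) assms(2), of "int m + 1"]
    by (auto simp: head_less_def split: list.splits)
  ultimately show ?thesis
    using c(2) by (auto simp: peaked_def m_def)
qed

lemma peak_test_2: "list_all (peak_test 2) [1..9]" by code_simp

text \<open>The case \<open>k = 3\<close>, \<open>lam = 1\<close> is exceptional: there \<open>order_coeff 3 1 4 < order_coeff 3 1 3\<close>, although
  the maximum is still at 5.\<close>

lemma peak_test_3: "list_all (peak_test 3) [2..9]" by code_simp

lemma peak_test_4: "list_all (peak_test 4) [1..9]" by code_simp

lemma peak_test_5: "list_all (peak_test 5) [1..6]" by code_simp

lemma peaked_small:
  assumes k: "k \<in> {2, 3, 4, 5}" and "1 \<le> l" "int l < threshold k" "\<not> (k = 3 \<and> l = 1)"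
  shows "peaked k l"
proof (rule peak_test_sound)
  have "int l \<in> {1..9}" "k = 3 \<Longrightarrow> int l \<in> {2..9}" "k = 5 \<Longrightarrow> int l \<in> {1..6}"
    using assms(2-4) by (auto simp: threshold_def split: if_splits)
  thus "peak_test k (int l)"
    using k peak_test_2 peak_test_3 peak_test_4 peak_test_5 unfolding list_all_iff set_upto by blast
qed (use assms in auto)

section \<open>Location of the mode\<close>

lemma half_le_triangle: "k \<in> {2, 3, 4, 5} \<Longrightarrow> k div 2 < k * (k + 1) div 2" for k :: nat
  by auto

lemma peaked_Suc:
  assumes k: "k \<in> {2, 3, 4, 5}" and l: "threshold k \<le> int l + 1" and "peaked k l"
  shows "peaked k (Suc l)"
proof -
  define K where "K = k * (k + 1) div 2"
  define m where "m = mode_index k (Suc l)"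
  let ?a = "order_coeff k (real (Suc l))"
  have K: "k div 2 < K" using half_le_triangle[OF k] by (simp add: K_def)
  have m_eq: "m = K + l * K - k div 2" "mode_index k l = l * K - k div 2"
    by (simp_all add: m_def mode_index_def K_def)
  have "l \<ge> 1" using l by (auto simp: threshold_def split: if_splits)
  hence "K \<le> l * K" by simp
  hence "k div 2 < l * K" using K by linarith
  hence m: "m + k div 2 = Suc l * K" "mode_index k l + K = m" "m \<ge> 1"
    unfolding m_eq mult_Suc by linarith+
  have sign: "of_int s * (?a x - ?a (x - 1)) > 0"
    if "sign_cert k (threshold k) s ps (int i)" "x + i = Suc l * K" "x \<ge> 1"
      "\<And>y. 1 \<le> y \<Longrightarrow> y < x \<Longrightarrow> ?a (y - 1) \<le> ?a y" for ps i s x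
    using that k l by (intro order_coeff_sign[of k "threshold k" s ps i]) (auto simp: K_def threshold_def)
  have strict: "?a (x - 1) < ?a x"
    if x: "mode_index k l < x" "x \<le> m" "\<And>y. 1 \<le> y \<Longrightarrow> y < x \<Longrightarrow> ?a (y - 1) \<le> ?a y" for x
  proof -
    have i: "k div 2 \<le> Suc l * K - x" "Suc l * K - x < k div 2 + K" "x + (Suc l * K - x) = Suc l * K"
      using x(1,2) m by linarith+
    obtain ps where ps: "sign_cert k (threshold k) 1 ps (int (Suc l * K - x))"
      using rising_cert_exists[OF k i(1,2)[unfolded K_def]] unfolding K_def by blast
    from sign[OF ps i(3) _ x(3)] show ?thesis using x(1) by simp
  qed
  \<comment> \<open>Up to the old mode the ascent is inherited by convolution with the sequence for
    parameter 1. Beyond it, the certificate at \<open>y\<close> uses all ascents before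
    \<open>y\<close>, hence the strong induction.\<close>
  have mono: "1 \<le> y \<Longrightarrow> y \<le> m \<Longrightarrow> ?a (y - 1) \<le> ?a y" for y
  proof (induction y rule: less_induct)
    case (less y)
    show ?case
    proof (cases "y \<le> mode_index k l")
      case True
      have "order_coeff k (real l + 1) (y - 1) \<le> order_coeff k (real l + 1) y"
        by (rule order_coeff_add_mono[OF _ _ less.prems(1) True])
           (use assms(3) in \<open>auto simp: peaked_def\<close>)
      thus ?thesis by (simp add: add.commute)
    next
      case False
      thus ?thesis using strict[of y] less by fastforce
    qed
  qed
  have "?a (m - 1) < ?a m"
    using K m mono by (intro strict) auto
  moreover have "?a (m + 1) < ?a m" if "k \<ge> 4"
  proof -
    \<comment> \<open>As \<open>k div 2 = 2\<close>, the index \<open>m + 1\<close> has distance 1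
      from \<open>N\<close>.\<close>
    have "sign_cert k (threshold k) (-1) (falling_cert k) 1" "k div 2 = 2"
      using that k falling_cert_valid by auto
    from sign[of _ _ 1, simplified, OF this(1), of "m + 1"] mono m this(2) show ?thesis by simp
  qed
  ultimately show ?thesis using mono by (auto simp: peaked_def m_def)
qed

lemma order_coeff_less_mode:
  assumes k: "k \<in> {2, 3, 4, 5}" and l: "l \<ge> 1"
  and m: "m + k div 2 = l * (k * (k + 1) div 2)"
  and below: "\<And>y. y < l * (k * (k + 1) div 2) \<Longrightarrow> y \<noteq> m \<Longrightarrow> order_coeff k (real l) y < order_coeff k (real l) m"
  and "x \<noteq> m"
  shows "order_coeff k (real l) x < order_coeff k (real l) m"
  using \<open>x \<noteq> m\<close>
proof (induction x rule: less_induct)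
  case (less x)
  let ?a = "order_coeff k (real l)"
  define N where "N = l * (k * (k + 1) div 2)"
  show ?case
  proof (cases "x < N")
    case True
    thus ?thesis using below less by (simp add: N_def)
  next
    case False
    have "k \<ge> 2" "k div 2 > 0" using k by auto
    have N: "real N = real l * (\<Sum>j=1..k. real j)"
      using sum_list_upto[of k] dot_upto[of k "\<lambda>_. 1" 0] gauss_sum_from_Suc_0[of k, where ?'a = nat]
      by (simp add: N_def flip: of_nat_sum)
    have pos: "?a m > 0" using l k by (intro order_coeff_pos) auto
    define t where "t = (\<lambda>j. real j * (if j \<le> x then ?a (x - j) else 0))"
    have le: "t j \<le> real j * ?a m" if "j \<in> {1..k}" for j
      using less.IH[of "x - j"] that pos by (cases "x - j = m") (auto simp: t_def)
    \<comment> \<open>Equality can occur only in the term with \<open>x - j = m\<close>; since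
      \<open>k \<ge> 2\<close>, one of \<open>j = 1\<close> and \<open>j = 2\<close> avoids it and
      makes the average strict.\<close>
    obtain j where j: "j \<in> {1..k}" "t j < real j * ?a m"
    proof (cases "x - 1 = m \<and> 1 \<le> x")
      case True
      hence "t 2 < real 2 * ?a m"
        using less.IH[of "x - 2"] pos by (auto simp: t_def)
      thus thesis using \<open>k \<ge> 2\<close> by (intro that[of 2]) auto
    next
      case False
      hence "t 1 < real 1 * ?a m"
        using less.IH[of "x - 1"] pos by (auto simp: t_def)
      thus thesis using \<open>k \<ge> 2\<close> by (intro that[of 1]) auto
    qed
    have "(\<Sum>j=1..k. t j) < (\<Sum>j=1..k. real j * ?a m)"
      by (rule sum_strict_mono_ex1) (use le j in auto)
    hence "real l * (\<Sum>j=1..k. t j) < real l * (\<Sum>j=1..k. real j * ?a m)"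
      using l by simp
    hence "real x * ?a x < real N * ?a m"
      unfolding order_coeff_rec[of x] t_def N by (simp add: sum_distrib_right mult.assoc)
    also have "\<dots> \<le> real x * ?a m" using False pos by simp
    finally show ?thesis by (simp add: mult_less_cancel_left)
  qed
qed

lemma peaked_imp_mode:
  assumes k: "k \<in> {2, 3, 4, 5}" and l: "l \<ge> 1" and p: "peaked k l" and "x \<noteq> mode_index k l"
  shows "order_coeff k (real l) x < order_coeff k (real l) (mode_index k l)"
proof (rule order_coeff_less_mode[OF k l])
  have "k * (k + 1) div 2 \<le> l * (k * (k + 1) div 2)" using l by simp
  hence "k div 2 < l * (k * (k + 1) div 2)" using half_le_triangle[OF k] by linarith
  thus m: "mode_index k l + k div 2 = l * (k * (k + 1) div 2)" by (simp add: mode_index_def)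
  fix y assume y: "y < l * (k * (k + 1) div 2)" "y \<noteq> mode_index k l"
  let ?a = "order_coeff k (real l)"
  show "?a y < ?a (mode_index k l)"
  proof (cases "y < mode_index k l")
    case True
    have "y \<le> z \<Longrightarrow> z \<le> mode_index k l \<Longrightarrow> ?a y \<le> ?a z" for z
    proof (induction z rule: dec_induct)
      case (step z)
      thus ?case using p by (force simp: peaked_def)
    qed simp
    hence "?a y \<le> ?a (mode_index k l - 1)" using True by simp
    also have "\<dots> < ?a (mode_index k l)" using p by (simp add: peaked_def)
    finally show ?thesis .
  next
    case False
    \<comment> \<open>Strictly between \<open>m\<close> and \<open>N = m + k div 2\<close> lies no
      index for \<open>k < 4\<close> and just one for \<open>k = 4, 5\<close>.\<close>
    hence "k \<ge> 4" "y = mode_index k l + 1" using y m k by auto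
    thus ?thesis using p by (simp add: peaked_def)
  qed
qed fact

text \<open>Here \<open>N = 6\<close>, so it suffices to compute the values at the indices below 6;
  the dip at 4 excludes the route through \<open>peaked\<close>.\<close>

lemma order_3_1_mode:
  assumes "x \<noteq> 5" shows "order_coeff 3 1 x < order_coeff 3 1 5"
proof -
  have rec: "real x * order_coeff 3 1 x = (\<Sum>j=1..3. real j * (if j \<le> x then order_coeff 3 1 (x - j) else 0))" for x
    using order_coeff_rec[of x 3 1] by simp
  have a: "order_coeff 3 1 1 = 1" "order_coeff 3 1 2 = 3/2" "order_coeff 3 1 3 = 13/6"
    "order_coeff 3 1 4 = 49/24" "order_coeff 3 1 5 = 87/40"
    using rec[of 1] rec[of 2] rec[of 3] rec[of 4] rec[of 5] by (simp_all add: numeral_3_eq_3 eval_nat_numeral)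
  have "order_coeff 3 (real 1) x < order_coeff 3 (real 1) 5"
  proof (rule order_coeff_less_mode)
    fix y assume "y < 1 * (3 * (3 + 1) div 2)" "y \<noteq> (5::nat)"
    hence "y \<in> {0, 1, 2, 3, 4}" by auto
    thus "order_coeff 3 (real 1) y < order_coeff 3 (real 1) 5"
      using a by auto
  qed (use assms in auto)
  thus ?thesis by simp
qed

lemma peaked_all:
  assumes k: "k \<in> {2, 3, 4, 5}" and "l \<ge> 1" "\<not> (k = 3 \<and> l = 1)"
  shows "peaked k l"
  using assms(2,3)
proof (induction l)
  case (Suc l)
  show ?case
  proof (cases "int (Suc l) < threshold k")
    case True
    thus ?thesis using Suc.prems by (intro peaked_small k)
  next
    case False
    \<comment> \<open>This keeps the induction hypothesis away from the exceptional pair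
      \<open>k = 3\<close>, \<open>l = 1\<close>.\<close>
    hence "l \<ge> 2" by (auto simp: threshold_def split: if_splits)
    thus ?thesis using False Suc.IH by (intro peaked_Suc k) auto
  qed
qed simp

theorem theorem2p2:
  fixes lam k :: nat
  assumes "lam \<ge> 1" and "k \<in> {2, 3, 4, 5}"
  shows "\<forall>x::nat. x \<noteq> lam * k * (k + 1) div 2 - k div 2 \<longrightarrow>
           poisson_order_pmf k (real lam) x
             < poisson_order_pmf k (real lam) (lam * k * (k + 1) div 2 - k div 2)"
proof (intro allI impI)
  fix x assume x: "x \<noteq> lam * k * (k + 1) div 2 - k div 2"
  \<comment> \<open>The theorem halves the whole product, \<open>mode_index\<close> only
    \<open>k * (k + 1)\<close>; they agree because the latter is even.\<close>
  have "lam * (k * (k + 1) div 2) = lam * (k * (k + 1)) div 2"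
    by (rule div_mult_swap) simp
  hence mode: "lam * k * (k + 1) div 2 - k div 2 = mode_index k lam"
    by (simp only: mode_index_def mult.assoc)
  have "order_coeff k (real lam) x < order_coeff k (real lam) (mode_index k lam)"
  proof (cases "k = 3 \<and> lam = 1")
    case True
    thus ?thesis using order_3_1_mode x mode by (simp add: mode_index_def)
  next
    case False
    thus ?thesis using assms x mode by (intro peaked_imp_mode peaked_all) auto
  qed
  thus "poisson_order_pmf k (real lam) x
      < poisson_order_pmf k (real lam) (lam * k * (k + 1) div 2 - k div 2)"
    unfolding mode poisson_order_pmf_eq by simp
qed

end
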